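(* Every space with enough arcs has the $\mathcal{AF}$-property.
   Context: For a metrizable space $X$, a continuous map $f\colon X\to X$ and a point $x\in X$, the $\alpha$-limit set of $x$ is $\alpha_f(x)=\bigcap_{n\ge 0}\overline{\bigcup_{k\ge n} f^{-k}(x)}$, where $f^{-k}(x)=\{y\in X: f^k(y)=x\}$. A set $A\subseteq X$ is an $\alpha$-limit set in $X$ if $A=\alpha_f(x)$ for some continuous $f\colon X\to X$ and some $x\in X$. A metrizable space $X$ has the $\mathcal{AF}$-property (is an $\mathcal{AF}$-space) if the $\alpha$-limit sets in $X$ are precisely the closed subsets of $X$ (including $\emptyset$ and $X$). An arc is a homeomorphic copy of $[0,1]$. A space is nondegenerate if it has at least two points. A space with enough arcs is a nondegenerate metrizable space $X$ such that for every nonempty proper closed subset $A\subseteq X$ there is an arc in $X$ with one endpoint in $A$ and the other endpoint in $X\setminus A$. *)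

theory Defs
  imports "HOL-Analysis.Abstract_Metric_Spaces"
begin

text \<open>Spaces are abstract topologies, so a self-map is an \<open>'a \<Rightarrow> 'a\<close> whose values outside
  \<open>topspace X\<close> are irrelevant; the preimages below are therefore taken inside \<open>topspace X\<close>.\<close>

definition alpha_limit :: "'a topology \<Rightarrow> ('a \<Rightarrow> 'a) \<Rightarrow> 'a \<Rightarrow> 'a set" where
  "alpha_limit X f x =
     (\<Inter>n. X closure_of (\<Union>k\<in>{n..}. {y \<in> topspace X. (f ^^ k) y = x}))"

definition is_alpha_limit_set :: "'a topology \<Rightarrow> 'a set \<Rightarrow> bool" where
  "is_alpha_limit_set X A \<longleftrightarrow>
     (\<exists>f x. continuous_map X X f \<and> x \<in> topspace X \<and> A = alpha_limit X f x)"

definition AF_space :: "'a topology \<Rightarrow> bool" where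
  "AF_space X \<longleftrightarrow>
     metrizable_space X \<and> {A. is_alpha_limit_set X A} = {A. closedin X A}"

text \<open>\<open>C\<close> is an arc in \<open>X\<close> with endpoints \<open>a\<close> and \<open>b\<close>.\<close>

definition arc_between :: "'a topology \<Rightarrow> 'a set \<Rightarrow> 'a \<Rightarrow> 'a \<Rightarrow> bool" where
  "arc_between X C a b \<longleftrightarrow>
     C \<subseteq> topspace X \<and>
     (\<exists>h. homeomorphic_map (top_of_set {0..1::real}) (subtopology X C) h \<and> h 0 = a \<and> h 1 = b)"

definition space_with_enough_arcs :: "'a topology \<Rightarrow> bool" where
  "space_with_enough_arcs X \<longleftrightarrow>
     metrizable_space X \<and>
     (\<exists>x\<in>topspace X. \<exists>y\<in>topspace X. x \<noteq> y) \<and>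
     (\<forall>A. closedin X A \<and> A \<noteq> {} \<and> A \<noteq> topspace X \<longrightarrow>
        (\<exists>C a b. arc_between X C a b \<and> a \<in> A \<and> b \<in> topspace X - A))"

end

theory Submission
  imports Defs
begin

text \<open>The empty set and the whole space are \<open>\<alpha>\<close>-limit sets of constant maps. For a nonempty proper
  closed set \<open>A\<close>, parametrize the given arc from \<open>A\<close> to its complement and cut off everything before
  its last visit to \<open>A\<close>: what remains is a path that starts at some \<open>a \<in> A\<close> and never meets \<open>A\<close>
  again. Run along this path with parameter (a truncation of) the distance to \<open>A\<close>. The resulting
  map \<open>f\<close> sends \<open>A\<close> to the single point \<open>a\<close>, which is the only point of \<open>A\<close> in its range, and it
  sends the complement of \<open>A\<close> into itself. Hence \<open>f\<^sup>-\<^sup>k(a) = A\<close> for every \<open>k \<ge> 1\<close>, and the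
  \<open>\<alpha>\<close>-limit set of \<open>a\<close> is the closure of \<open>A\<close>, that is \<open>A\<close>.\<close>

lemma closedin_alpha_limit: "closedin X (alpha_limit X f x)"
  unfolding alpha_limit_def by (rule closedin_Inter) auto

text \<open>In contrast to normality, metrizability gives a function that vanishes on \<open>A\<close> and nowhere
  else. The distance to \<open>A\<close> is such a function because it is Lipschitz with constant 1, and a point
  outside \<open>A\<close> is the centre of a ball that misses \<open>A\<close>.\<close>

lemma closedin_zero_set:
  assumes "metrizable_space X" "closedin X A" "A \<noteq> {}"
  obtains \<phi> :: "'a \<Rightarrow> real"
  where "continuous_map X euclideanreal \<phi>"
    and "\<And>x. x \<in> topspace X \<Longrightarrow> 0 \<le> \<phi> x"
    and "\<And>x. x \<in> topspace X \<Longrightarrow> \<phi> x = 0 \<longleftrightarrow> x \<in> A"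
proof -
  obtain M d where "Metric_space M d" and X: "X = Metric_space.mtopology M d"
    using assms(1) unfolding metrizable_space_def by blast
  interpret Metric_space M d by fact
  have top: "topspace X = M" by (simp add: X)
  have AM: "A \<subseteq> M" using closedin_subset[OF assms(2)] top by simp
  define \<phi> where "\<phi> x = (INF a\<in>A. d x a)" for x
  have bdd: "bdd_below ((\<lambda>a. d x a) ` A)" for x
    by (rule bdd_belowI[of _ 0]) auto
  have le: "\<phi> x \<le> d x a" if "a \<in> A" for x a
    unfolding \<phi>_def by (rule cINF_lower[OF bdd that])
  have nonneg: "0 \<le> \<phi> x" for x
    unfolding \<phi>_def by (rule cINF_greatest[OF assms(3)]) auto
  have lip: "\<phi> x \<le> d x y + \<phi> y" if "x \<in> M" "y \<in> M" for x y
  proof -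
    have "\<phi> x - d x y \<le> d y a" if "a \<in> A" for a
      using le[OF that, of x] triangle[OF \<open>x \<in> M\<close> \<open>y \<in> M\<close>, of a] that AM by fastforce
    then have "\<phi> x - d x y \<le> \<phi> y"
      unfolding \<phi>_def[of y] by (rule cINF_greatest[OF assms(3)])
    then show ?thesis by simp
  qed
  have zero: "\<phi> x = 0 \<longleftrightarrow> x \<in> A" if x: "x \<in> M" for x
  proof
    assume "x \<in> A"
    then show "\<phi> x = 0" using le[of x x] nonneg[of x] x by simp
  next
    assume z: "\<phi> x = 0"
    show "x \<in> A"
    proof (rule ccontr)
      assume "x \<notin> A"
      then obtain r where "r > 0" and r: "disjnt A (mball x r)"
        using assms(2) x unfolding X closedin_metric by blast
      have "r \<le> d x a" if "a \<in> A" for a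
        using r that x AM by (force simp: disjnt_iff)
      then have "r \<le> \<phi> x"
        unfolding \<phi>_def by (rule cINF_greatest[OF assms(3)])
      with z \<open>r > 0\<close> show False by simp
    qed
  qed
  have "continuous_map X euclideanreal \<phi>"
    unfolding X mtopology_is_euclidean[symmetric]
  proof (subst metric_continuous_map[OF Met_TC.Metric_space_axioms], intro conjI strip)
    show "\<phi> ` M \<subseteq> UNIV" by simp
    fix x and \<epsilon> :: real
    assume "0 < \<epsilon>" "x \<in> M"
    have "dist (\<phi> x) (\<phi> y) < \<epsilon>" if "y \<in> M" "d x y < \<epsilon>" for y
      using lip[OF \<open>x \<in> M\<close> that(1)] lip[OF that(1) \<open>x \<in> M\<close>] that(2) commute[of x y]
      by (auto simp: dist_real_def)
    then show "\<exists>\<delta>>0. \<forall>y. y \<in> M \<and> d x y < \<delta> \<longrightarrow> dist (\<phi> x) (\<phi> y) < \<epsilon>"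
      using \<open>0 < \<epsilon>\<close> by blast
  qed
  then show thesis
    using that nonneg zero top by blast
qed

text \<open>All iterated preimages of \<open>a\<close> equal \<open>A\<close>, because a point whose image lies in \<open>A\<close> already
  lies in \<open>A\<close>. The exceptional preimage \<open>{a}\<close> under the zeroth iterate does no harm, as \<open>a \<in> A\<close>.\<close>

lemma alpha_limit_eqI:
  assumes f: "f \<in> topspace X \<rightarrow> topspace X" and A: "closedin X A" and a: "a \<in> A"
    and fib: "\<And>y. y \<in> topspace X \<Longrightarrow> f y = a \<longleftrightarrow> y \<in> A"
    and inv: "\<And>y. y \<in> topspace X \<Longrightarrow> f y \<in> A \<longleftrightarrow> y \<in> A"
  shows "alpha_limit X f a = A"
proof -
  have AX: "A \<subseteq> topspace X" using A by (rule closedin_subset)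
  have iter: "(f ^^ Suc k) y = a \<longleftrightarrow> y \<in> A" if "y \<in> topspace X" for k y
    using that
  proof (induction k arbitrary: y)
    case 0
    then show ?case using fib by simp
  next
    case (Suc k)
    have "(f ^^ Suc (Suc k)) y = (f ^^ Suc k) (f y)"
      by (simp add: funpow_swap1)
    then show ?case using Suc f inv by (metis funcset_mem)
  qed
  have "(\<Union>k\<in>{n..}. {y \<in> topspace X. (f ^^ k) y = a}) = A" for n
  proof
    have "{y \<in> topspace X. (f ^^ k) y = a} \<subseteq> A" for k
      using a iter by (cases k) auto
    then show "(\<Union>k\<in>{n..}. {y \<in> topspace X. (f ^^ k) y = a}) \<subseteq> A" by blast
    have "A \<subseteq> {y \<in> topspace X. (f ^^ Suc n) y = a}"
      using iter AX by blast
    then show "A \<subseteq> (\<Union>k\<in>{n..}. {y \<in> topspace X. (f ^^ k) y = a})"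
      by (meson UN_upper atLeast_iff le_SucI order_refl subset_trans)
  qed
  then show ?thesis
    using closure_of_closedin[OF A] by (simp add: alpha_limit_def)
qed

lemma empty_is_alpha_limit_set:
  fixes X :: "'a topology"
  assumes "x \<in> topspace X" "c \<in> topspace X" "x \<noteq> c"
  shows "is_alpha_limit_set X {}"
proof -
  have "((\<lambda>_. c) ^^ k) y \<noteq> x" if "k \<ge> 1" for k and y :: 'a
    using that assms(3) by (cases k) simp_all
  then have "(\<Union>k\<in>{1..}. {y \<in> topspace X. ((\<lambda>_. c) ^^ k) y = x}) = {}"
    by auto
  then have "alpha_limit X (\<lambda>_. c) x = {}"
    unfolding alpha_limit_def by (metis (no_types, lifting) INT_lower UNIV_I closure_of_empty subset_empty)
  then show ?thesis
    unfolding is_alpha_limit_set_def using assms by (metis continuous_map_const)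
qed

lemma topspace_is_alpha_limit_set:
  assumes "c \<in> topspace X"
  shows "is_alpha_limit_set X (topspace X)"
proof -
  have "alpha_limit X (\<lambda>_. c) c = topspace X"
    by (rule alpha_limit_eqI) (use assms in auto)
  then show ?thesis
    unfolding is_alpha_limit_set_def using assms by (metis continuous_map_const)
qed

text \<open>The parameter of the last visit to \<open>A\<close> exists because the parameters of all visits form a
  compact set; it is not \<open>1\<close>, since the arc ends outside \<open>A\<close>.\<close>

lemma arc_between_last_visit:
  assumes arc: "arc_between X C a b" and A: "closedin X A" and "a \<in> A" "b \<notin> A"
  obtains h :: "real \<Rightarrow> 'a" and s
  where "continuous_map (top_of_set {0..1}) X h" "0 \<le> s" "s < 1"
    and "\<And>t. \<lbrakk>s \<le> t; t \<le> 1\<rbrakk> \<Longrightarrow> h t \<in> A \<longleftrightarrow> t = s"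
proof -
  obtain h where hom: "homeomorphic_map (top_of_set {0..1::real}) (subtopology X C) h"
    and h: "h 0 = a" "h 1 = b"
    using arc unfolding arc_between_def by blast
  have cont: "continuous_map (top_of_set {0..1}) X h"
    using homeomorphic_imp_continuous_map[OF hom] continuous_map_into_fulltopology by blast
  define T where "T = {t \<in> {0..1}. h t \<in> A}"
  have "closedin (top_of_set {0..1}) T"
    using closedin_continuous_map_preimage[OF cont A] by (simp add: T_def)
  then have "compact T"
    by (rule closedin_compact[OF compact_Icc])
  moreover have "T \<noteq> {}"
    using h \<open>a \<in> A\<close> by (force simp: T_def)
  ultimately obtain s where s: "s \<in> T" "\<And>t. t \<in> T \<Longrightarrow> t \<le> s"
    using compact_attains_sup by metis
  have "s \<noteq> 1"
    using s(1) h \<open>b \<notin> A\<close> by (auto simp: T_def)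
  show thesis
  proof (rule that[OF cont])
    show "0 \<le> s" "s < 1"
      using s(1) \<open>s \<noteq> 1\<close> by (auto simp: T_def)
    show "h t \<in> A \<longleftrightarrow> t = s" if "s \<le> t" "t \<le> 1" for t
      using s(1) s(2)[of t] that by (auto simp: T_def)
  qed
qed

lemma proper_closed_is_alpha_limit_set:
  assumes "metrizable_space X" and A: "closedin X A"
    and arc: "arc_between X C a b" and "a \<in> A" "b \<notin> A"
  shows "is_alpha_limit_set X A"
proof -
  obtain h :: "real \<Rightarrow> 'a" and s
    where h: "continuous_map (top_of_set {0..1}) X h" and s: "0 \<le> s" "s < 1"
      and last: "\<And>t. \<lbrakk>s \<le> t; t \<le> 1\<rbrakk> \<Longrightarrow> h t \<in> A \<longleftrightarrow> t = s"
    using arc_between_last_visit[OF arc A \<open>a \<in> A\<close> \<open>b \<notin> A\<close>] by blast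
  obtain \<phi> :: "'a \<Rightarrow> real" where \<phi>: "continuous_map X euclideanreal \<phi>"
    and nonneg: "\<And>x. x \<in> topspace X \<Longrightarrow> 0 \<le> \<phi> x"
    and zero: "\<And>x. x \<in> topspace X \<Longrightarrow> \<phi> x = 0 \<longleftrightarrow> x \<in> A"
    using closedin_zero_set[OF assms(1) A] \<open>a \<in> A\<close> by blast
  define g where "g x = min 1 (s + \<phi> x)" for x
  have g_ge: "s \<le> g x" and g_le: "g x \<le> 1" and g_eq: "g x = s \<longleftrightarrow> x \<in> A"
    if "x \<in> topspace X" for x
    using nonneg[OF that] zero[OF that] s by (auto simp: g_def min_def)
  have "continuous_map X euclideanreal g"
    unfolding g_def by (intro continuous_map_real_min continuous_map_add \<phi>) auto
  then have "continuous_map X (top_of_set {0..1}) g"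
    using g_ge g_le s(1) by (fastforce simp: continuous_map_in_subtopology)
  then have cont: "continuous_map X X (h \<circ> g)"
    using h by (rule continuous_map_compose)
  have hs: "h s \<in> A"
    using last[of s] s by simp
  have inv: "(h \<circ> g) y \<in> A \<longleftrightarrow> y \<in> A" if "y \<in> topspace X" for y
    using last[OF g_ge g_le] g_eq that by simp
  have fib: "(h \<circ> g) y = h s \<longleftrightarrow> y \<in> A" if "y \<in> topspace X" for y
    using inv[OF that] hs g_eq[OF that] by auto
  have "alpha_limit X (h \<circ> g) (h s) = A"
    using continuous_map_funspace[OF cont] A hs fib inv by (rule alpha_limit_eqI)
  moreover have "h s \<in> topspace X"
    using hs closedin_subset[OF A] by blast
  ultimately show ?thesis
    unfolding is_alpha_limit_set_def using cont by blast
qed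

theorem proposition6:
  fixes X :: "'a topology"
  assumes "space_with_enough_arcs X"
  shows "AF_space X"
proof -
  have met: "metrizable_space X"
    using assms by (simp add: space_with_enough_arcs_def)
  obtain x y where xy: "x \<in> topspace X" "y \<in> topspace X" "x \<noteq> y"
    using assms unfolding space_with_enough_arcs_def by blast
  have "is_alpha_limit_set X A" if A: "closedin X A" for A
  proof -
    consider "A = {}" | "A = topspace X" | "A \<noteq> {}" "A \<noteq> topspace X" by blast
    then show ?thesis
    proof cases
      case 1
      then show ?thesis using empty_is_alpha_limit_set[OF xy] by simp
    next
      case 2
      then show ?thesis using topspace_is_alpha_limit_set[OF xy(1)] by simp
    next
      case 3
      then obtain C a b where "arc_between X C a b" "a \<in> A" "b \<in> topspace X - A"
        using assms A unfolding space_with_enough_arcs_def by meson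
      then show ?thesis
        using proper_closed_is_alpha_limit_set[OF met A] by blast
    qed
  qed
  moreover have "closedin X A" if "is_alpha_limit_set X A" for A
    using that closedin_alpha_limit unfolding is_alpha_limit_set_def by metis
  ultimately show ?thesis
    unfolding AF_space_def using met by blast
qed

end
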